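(* Let $B$ be a two-sided skew brace (not necessarily finite) and let $I$ be an ideal of $B$. Then the first term of the derived series of $I$, computed in $I$, is an ideal of $B$; that is, $\partial_I^1(I)=[I,I]_I$ is an ideal of $B$.
   Context: A skew brace is a triple $B=(B,+,\cdot)$ such that $(B,+)$ and $(B,\cdot)$ are groups (neither assumed abelian) on the same underlying set and $a\cdot(b+c)=a\cdot b-a+a\cdot c$ for all $a,b,c\in B$. It is two-sided if moreover $(a+b)\cdot c=a\cdot c-c+b\cdot c$ for all $a,b,c\in B$. The two identity elements coincide and are denoted by $0$. For $a\in B$, $\lambda_a(b)=-a+a\cdot b$ defines an automorphism of $(B,+)$. A left ideal of $B$ is a subgroup $I\leq (B,+)$ with $\lambda_b(I)=I$ for every $b\in B$. An ideal of $B$ is a left ideal that is normal in both $(B,+)$ and $(B,\cdot)$; an ideal is a skew brace in its own right under the restricted operations. For a skew brace $A$ and ideals $I,J$ of $A$, the commutator $[I,J]_A$ is the ideal of $A$ generated by $[I,J]_+\cup[I,J]_\cdot\cup\{\,i\cdot j-(i+j)\mid i\in I,\ j\in J\,\}$, where $[I,J]_+$ and $[I,J]_\cdot$ are the commutator subgroups taken in $(A,+)$ and $(A,\cdot)$. Thus $[I,I]_I$ is the ideal of the skew brace $I$ (not of $B$) obtained by taking $A=I=J$. The derived series of an ideal $I$ of $A$ with respect to $A$ is $\partial_A^0(I)=I$, $\partial_A^{n+1}(I)=[\partial_A^n(I),\partial_A^n(I)]_A$. *)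

theory Defs
  imports "HOL-Algebra.Algebra"
begin

text \<open>
  A skew brace is carried by a ring record: \<open>add_monoid B\<close> is the group \<open>(B,+)\<close> and \<open>B\<close> itself,
  seen as a monoid record, is the group \<open>(B,\<cdot>)\<close>. Neither group is assumed abelian, so the ring
  locales are not used, and the order of summands matters.
\<close>

locale skew_brace =
  fixes B :: "('a, 'm) ring_scheme" (structure)
  assumes add_group: "group (add_monoid B)"
    and mult_group: "group B"
    and skew_distrib:
      "\<lbrakk>a \<in> carrier B; b \<in> carrier B; c \<in> carrier B\<rbrakk>
        \<Longrightarrow> a \<otimes> (b \<oplus> c) = a \<otimes> b \<ominus> a \<oplus> a \<otimes> c"

locale two_sided_skew_brace = skew_brace +
  assumes skew_distrib_right:
      "\<lbrakk>a \<in> carrier B; b \<in> carrier B; c \<in> carrier B\<rbrakk>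
        \<Longrightarrow> (a \<oplus> b) \<otimes> c = a \<otimes> c \<ominus> c \<oplus> b \<otimes> c"

definition brace_lambda :: "('a, 'm) ring_scheme \<Rightarrow> 'a \<Rightarrow> 'a \<Rightarrow> 'a"
  where "brace_lambda B a b = \<ominus>\<^bsub>B\<^esub> a \<oplus>\<^bsub>B\<^esub> a \<otimes>\<^bsub>B\<^esub> b"

definition brace_left_ideal :: "('a, 'm) ring_scheme \<Rightarrow> 'a set \<Rightarrow> bool"
  where "brace_left_ideal B I \<longleftrightarrow>
    subgroup I (add_monoid B) \<and> (\<forall>b \<in> carrier B. brace_lambda B b ` I = I)"

definition brace_ideal :: "('a, 'm) ring_scheme \<Rightarrow> 'a set \<Rightarrow> bool"
  where "brace_ideal B I \<longleftrightarrow> brace_left_ideal B I \<and> I \<lhd> add_monoid B \<and> I \<lhd> B"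

definition brace_ideal_generated :: "('a, 'm) ring_scheme \<Rightarrow> 'a set \<Rightarrow> 'a set"
  where "brace_ideal_generated B S = \<Inter>{K. brace_ideal B K \<and> S \<subseteq> K}"

text \<open>The library's \<open>derived\<close> only covers the commutator subgroup of a set with itself.\<close>

definition commutator_subgroup :: "('a, 'm) monoid_scheme \<Rightarrow> 'a set \<Rightarrow> 'a set \<Rightarrow> 'a set"
  where "commutator_subgroup G H K =
    generate G {h \<otimes>\<^bsub>G\<^esub> k \<otimes>\<^bsub>G\<^esub> inv\<^bsub>G\<^esub> h \<otimes>\<^bsub>G\<^esub> inv\<^bsub>G\<^esub> k | h k. h \<in> H \<and> k \<in> K}"

definition brace_commutator :: "('a, 'm) ring_scheme \<Rightarrow> 'a set \<Rightarrow> 'a set \<Rightarrow> 'a set"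
  where "brace_commutator A I J =
    brace_ideal_generated A
      (commutator_subgroup (add_monoid A) I J \<union> commutator_subgroup A I J \<union>
       {i \<otimes>\<^bsub>A\<^esub> j \<ominus>\<^bsub>A\<^esub> (i \<oplus>\<^bsub>A\<^esub> j) | i j. i \<in> I \<and> j \<in> J})"

primrec brace_derived_series :: "('a, 'm) ring_scheme \<Rightarrow> 'a set \<Rightarrow> nat \<Rightarrow> 'a set"
  where
    "brace_derived_series A I 0 = I"
  | "brace_derived_series A I (Suc n) =
      brace_commutator A (brace_derived_series A I n) (brace_derived_series A I n)"

lemma brace_derived_series_one: "brace_derived_series A I 1 = brace_commutator A I I"
  by simp

lemma commutator_subgroup_self: "commutator_subgroup G H H = derived G H"
  unfolding commutator_subgroup_def derived_def by (rule arg_cong[where f = "generate G"]) blast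

context skew_brace
begin

lemma zero_eq_one: "\<zero> = \<one>"
proof -
  interpret A: group "add_monoid B" by (rule add_group)
  interpret M: group B by (rule mult_group)
  have c: "\<one> \<in> carrier B" "\<zero> \<in> carrier B" "\<ominus> \<one> \<in> carrier B"
    using A.inv_closed[of "\<one>"] A.one_closed by (auto simp: a_inv_def)
  have z: "\<zero> \<oplus> x = x" "x \<oplus> \<zero> = x" if "x \<in> carrier B" for x
    using A.l_one[of x] A.r_one[of x] that by auto
  have "\<one> \<otimes> (\<zero> \<oplus> \<zero>) = \<one> \<otimes> \<zero> \<ominus> \<one> \<oplus> \<one> \<otimes> \<zero>"
    using skew_distrib c by blast
  then have "\<zero> = \<ominus> \<one>"
    using c by (simp add: z a_minus_def)
  then have "\<one> \<oplus> \<zero> = \<zero>"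
    using A.r_inv[of "\<one>"] c by (simp add: a_inv_def)
  then show ?thesis using c by (simp add: z)
qed

lemma brace_ideal_carrier: "brace_ideal B (carrier B)"
proof -
  interpret A: group "add_monoid B" by (rule add_group)
  interpret M: group B by (rule mult_group)
  have "brace_lambda B b ` carrier B = carrier B" if b: "b \<in> carrier B" for b
  proof
    have nb: "\<ominus> b \<in> carrier B" using A.inv_closed[of b] b by (simp add: a_inv_def)
    show "brace_lambda B b ` carrier B \<subseteq> carrier B"
      using A.m_closed nb b by (auto simp: brace_lambda_def)
    show "carrier B \<subseteq> brace_lambda B b ` carrier B"
    proof
      fix y assume y: "y \<in> carrier B"
      have by': "b \<oplus> y \<in> carrier B" using A.m_closed[of b y] b y by simp
      have "b \<otimes> (inv b \<otimes> (b \<oplus> y)) = b \<oplus> y"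
        using b by' by (simp add: M.m_assoc[symmetric])
      moreover have "\<ominus> b \<oplus> (b \<oplus> y) = y"
        using A.m_assoc[of "\<ominus> b" b y] A.l_inv[of b] A.l_one[of y] b y nb by (simp add: a_inv_def)
      ultimately have "y = brace_lambda B b (inv b \<otimes> (b \<oplus> y))"
        by (simp add: brace_lambda_def)
      then show "y \<in> brace_lambda B b ` carrier B" using b by' by blast
    qed
  qed
  moreover have "carrier B \<lhd> add_monoid B" "carrier B \<lhd> B"
    using A.normal_inv_iff[of "carrier B"] A.subgroup_self
      M.normal_inv_iff[of "carrier B"] M.subgroup_self A.m_closed A.inv_closed by auto
  ultimately show ?thesis
    unfolding brace_ideal_def brace_left_ideal_def using A.subgroup_self by auto
qed

lemma skew_brace_restrict:
  assumes "brace_ideal B I"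
  shows "skew_brace (B\<lparr>carrier := I\<rparr>)"
proof -
  interpret A: group "add_monoid B" by (rule add_group)
  interpret M: group B by (rule mult_group)
  have sA: "subgroup I (add_monoid B)" and sM: "subgroup I B"
    using assms unfolding brace_ideal_def by (auto dest: normal_imp_subgroup)
  have sub: "I \<subseteq> carrier B" using subgroup.subset[OF sM] .
  have inv: "\<ominus>\<^bsub>B\<lparr>carrier := I\<rparr>\<^esub> x = \<ominus> x" if "x \<in> I" for x
    using A.m_inv_consistent[OF sA that] by (simp add: a_inv_def)
  show ?thesis
  proof (rule skew_brace.intro)
    show "group (add_monoid (B\<lparr>carrier := I\<rparr>))"
      using A.subgroup_imp_group[OF sA] by simp
    show "group (B\<lparr>carrier := I\<rparr>)" using M.subgroup_imp_group[OF sM] .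
    fix a b c
    assume "a \<in> carrier (B\<lparr>carrier := I\<rparr>)" "b \<in> carrier (B\<lparr>carrier := I\<rparr>)"
      "c \<in> carrier (B\<lparr>carrier := I\<rparr>)"
    then show "a \<otimes>\<^bsub>B\<lparr>carrier := I\<rparr>\<^esub> (b \<oplus>\<^bsub>B\<lparr>carrier := I\<rparr>\<^esub> c) =
      a \<otimes>\<^bsub>B\<lparr>carrier := I\<rparr>\<^esub> b \<ominus>\<^bsub>B\<lparr>carrier := I\<rparr>\<^esub> a \<oplus>\<^bsub>B\<lparr>carrier := I\<rparr>\<^esub> a \<otimes>\<^bsub>B\<lparr>carrier := I\<rparr>\<^esub> c"
      using skew_distrib[of a b c] sub inv by (auto simp: a_minus_def)
  qed
qed

end

end

theory Submission
  imports Defs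
begin

text \<open>
  Write \<open>i * j = \<lambda>\<^sub>i(j) - j\<close>. The ideal \<open>[I,I]\<^sub>I\<close> is the additive subgroup generated by the additive
  commutators of \<open>I\<close> and the elements \<open>i * j\<close> with \<open>i, j \<in> I\<close>. Both kinds of generators are permuted
  by \<open>\<lambda>\<^sub>b\<close>, because \<open>\<lambda>\<^sub>b(i * j) = (b i b\<^sup>-\<^sup>1) * \<lambda>\<^sub>b(j)\<close>, and they are stable under additive conjugation by
  \<open>b\<close> modulo additive commutators, because \<open>\<lambda>\<^sub>i(b) - b \<in> I\<close>. Two-sidedness makes multiplicative
  conjugation by \<open>b\<close> an automorphism of the skew brace \<open>B\<close>, which gives the remaining normality.
\<close>

definition derived_gens :: "('a, 'm) ring_scheme \<Rightarrow> 'a set \<Rightarrow> 'a set"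
  where "derived_gens B I =
    {h \<oplus>\<^bsub>B\<^esub> k \<oplus>\<^bsub>B\<^esub> \<ominus>\<^bsub>B\<^esub> h \<oplus>\<^bsub>B\<^esub> \<ominus>\<^bsub>B\<^esub> k | h k. h \<in> I \<and> k \<in> I} \<union>
    {brace_lambda B i j \<oplus>\<^bsub>B\<^esub> \<ominus>\<^bsub>B\<^esub> j | i j. i \<in> I \<and> j \<in> I}"

text \<open>Generated only as an additive subgroup, not as an ideal, so that for an ideal
  \<open>I\<close> the same set arises inside \<open>I\<close> and inside \<open>B\<close>.\<close>

definition derived_span :: "('a, 'm) ring_scheme \<Rightarrow> 'a set \<Rightarrow> 'a set"
  where "derived_span B I = generate (add_monoid B) (derived_gens B I)"

context skew_brace
begin

sublocale A: group "add_monoid B"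
  rewrites "carrier (add_monoid B) = carrier B"
    and "monoid.mult (add_monoid B) = ring.add B"
    and "monoid.one (add_monoid B) = ring.zero B"
    and "m_inv (add_monoid B) = a_inv B"
  by (rule add_group) (auto simp: a_inv_def fun_eq_iff)

sublocale M: group B
  by (rule mult_group)

abbreviation lam :: "'a \<Rightarrow> 'a \<Rightarrow> 'a" where "lam \<equiv> brace_lambda B"

lemma add_inv_cancel [simp]:
  assumes "x \<in> carrier B" "y \<in> carrier B"
  shows "x \<oplus> (\<ominus> x \<oplus> y) = y" "\<ominus> x \<oplus> (x \<oplus> y) = y"
  using assms by (simp_all add: A.m_assoc [symmetric])

lemma mult_inv_cancel [simp]:
  assumes "x \<in> carrier B" "y \<in> carrier B"
  shows "x \<otimes> (inv x \<otimes> y) = y" "inv x \<otimes> (x \<otimes> y) = y"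
  using assms by (simp_all add: M.m_assoc [symmetric])

lemmas add_word_simps = A.m_assoc A.inv_mult_group

section \<open>The action \<open>lam\<close> of the multiplicative group on the additive
  group\<close>

lemma lam_closed [simp]: "\<lbrakk>a \<in> carrier B; x \<in> carrier B\<rbrakk> \<Longrightarrow> lam a x \<in> carrier B"
  by (simp add: brace_lambda_def)

lemma mult_eq_lam: "\<lbrakk>a \<in> carrier B; x \<in> carrier B\<rbrakk> \<Longrightarrow> a \<otimes> x = a \<oplus> lam a x"
  by (simp add: brace_lambda_def)

lemma lam_add:
  "\<lbrakk>a \<in> carrier B; x \<in> carrier B; y \<in> carrier B\<rbrakk> \<Longrightarrow> lam a (x \<oplus> y) = lam a x \<oplus> lam a y"
  by (simp add: brace_lambda_def skew_distrib a_minus_def A.m_assoc)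

lemma lam_hom: "a \<in> carrier B \<Longrightarrow> lam a \<in> hom (add_monoid B) (add_monoid B)"
  by (simp add: hom_def lam_add)

lemma add_end_minus:
  assumes "f \<in> hom (add_monoid B) (add_monoid B)" "x \<in> carrier B"
  shows "f (\<ominus> x) = \<ominus> f x"
proof -
  interpret group_hom "add_monoid B" "add_monoid B" f
    by (simp add: group_hom_def group_hom_axioms_def add_group assms)
  show ?thesis using hom_inv [of x] assms by (simp add: a_inv_def)
qed

lemmas lam_minus = add_end_minus [OF lam_hom]

text \<open>Expanding \<open>lam b x\<close> and using additivity of \<open>lam a\<close>, the two
  contributions of \<open>a\<close> cancel. This is the action law of the multiplicative
  group.\<close>

lemma lam_lam:
  assumes "a \<in> carrier B" "b \<in> carrier B" "x \<in> carrier B"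
  shows "lam (a \<otimes> b) x = lam a (lam b x)"
proof -
  have "lam a (lam b x) = \<ominus> lam a b \<oplus> lam a (b \<otimes> x)"
    using assms by (simp add: brace_lambda_def [of B b] lam_add lam_minus)
  also have "\<dots> = lam (a \<otimes> b) x"
    using assms by (simp add: brace_lambda_def add_word_simps M.m_assoc)
  finally show ?thesis by simp
qed

lemma lam_one [simp]: "x \<in> carrier B \<Longrightarrow> lam \<one> x = x"
  using A.inv_one by (simp add: brace_lambda_def zero_eq_one)

text \<open>The product \<open>a \<otimes> inv a\<close> is the common identity of both groups. This
  converts multiplicative inverses into additive ones.\<close>

lemma lam_inv: "a \<in> carrier B \<Longrightarrow> lam a (inv a) = \<ominus> a"
  by (simp add: brace_lambda_def zero_eq_one [symmetric])

section \<open>Ideals through elementwise closure conditions\<close>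

lemma brace_idealI:
  assumes sub: "subgroup T (add_monoid B)"
    and lam: "\<And>b x. \<lbrakk>b \<in> carrier B; x \<in> T\<rbrakk> \<Longrightarrow> lam b x \<in> T"
    and add: "\<And>b x. \<lbrakk>b \<in> carrier B; x \<in> T\<rbrakk> \<Longrightarrow> b \<oplus> x \<oplus> \<ominus> b \<in> T"
    and mult: "\<And>b x. \<lbrakk>b \<in> carrier B; x \<in> T\<rbrakk> \<Longrightarrow> b \<otimes> x \<otimes> inv b \<in> T"
  shows "brace_ideal B T"
proof -
  have T: "x \<in> carrier B" if "x \<in> T" for x
    using subgroup.mem_carrier [OF sub that] by simp
  have minus: "\<ominus> x \<in> T" if "x \<in> T" for x
    using subgroup.m_inv_closed [OF sub that] by (simp add: a_inv_def)
  have "subgroup T B"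
  proof
    show "T \<subseteq> carrier B" using T by blast
    \<comment> \<open>The product is \<open>x \<oplus> lam x y\<close>, so invariance under
      \<open>lam\<close> makes an additive subgroup multiplicatively closed.\<close>
    show "x \<otimes> y \<in> T" if "x \<in> T" "y \<in> T" for x y
      using that subgroup.m_closed [OF sub that(1) lam [OF T that(2)]] by (simp add: mult_eq_lam T)
    show "\<one> \<in> T" using subgroup.one_closed [OF sub] by (simp add: zero_eq_one)
    fix x assume x: "x \<in> T"
    \<comment> \<open>This is \<open>lam_inv\<close> at \<open>inv x\<close>, whose inverse is
      \<open>x\<close>; it exhibits \<open>inv x\<close> as the negative of an element of
      \<open>T\<close>.\<close>
    have "\<ominus> lam (inv x) x = inv x"
      using lam_inv [of "inv x"] x by (simp add: T)
    then show "inv x \<in> T" using minus lam x by (metis M.inv_closed T)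
  qed
  moreover have "lam b ` T = T" if b: "b \<in> carrier B" for b
  proof
    show "lam b ` T \<subseteq> T" using lam b by blast
    show "T \<subseteq> lam b ` T"
    proof
      fix x assume x: "x \<in> T"
      have "x = lam b (lam (inv b) x)" using b x T by (simp add: lam_lam [symmetric])
      then show "x \<in> lam b ` T" using lam b x by blast
    qed
  qed
  moreover have "T \<lhd> add_monoid B"
    using A.normal_inv_iff [of T] sub add by simp
  ultimately show ?thesis
    unfolding brace_ideal_def brace_left_ideal_def using sub mult by (simp add: M.normal_inv_iff)
qed

lemma brace_idealD:
  assumes "brace_ideal B I"
  shows "subgroup I (add_monoid B)" "subgroup I B" "I \<subseteq> carrier B"
    and "\<lbrakk>b \<in> carrier B; x \<in> I\<rbrakk> \<Longrightarrow> lam b x \<in> I"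
    and "\<lbrakk>b \<in> carrier B; x \<in> I\<rbrakk> \<Longrightarrow> b \<oplus> x \<oplus> \<ominus> b \<in> I"
    and "\<lbrakk>b \<in> carrier B; x \<in> I\<rbrakk> \<Longrightarrow> b \<otimes> x \<otimes> inv b \<in> I"
    and "\<lbrakk>x \<in> I; y \<in> I\<rbrakk> \<Longrightarrow> x \<oplus> y \<in> I"
    and "x \<in> I \<Longrightarrow> \<ominus> x \<in> I"
proof -
  have n: "I \<lhd> add_monoid B" "I \<lhd> B" "brace_left_ideal B I"
    using assms by (auto simp: brace_ideal_def)
  show s: "subgroup I (add_monoid B)" "subgroup I B"
    using n by (auto dest: normal_imp_subgroup)
  show "I \<subseteq> carrier B" using subgroup.subset [OF s(2)] .
  show "\<lbrakk>b \<in> carrier B; x \<in> I\<rbrakk> \<Longrightarrow> lam b x \<in> I"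
    using n(3) by (auto simp: brace_left_ideal_def)
  show "\<lbrakk>b \<in> carrier B; x \<in> I\<rbrakk> \<Longrightarrow> b \<oplus> x \<oplus> \<ominus> b \<in> I"
    using n(1) A.normal_inv_iff [of I] by simp
  show "\<lbrakk>b \<in> carrier B; x \<in> I\<rbrakk> \<Longrightarrow> b \<otimes> x \<otimes> inv b \<in> I"
    using n(2) by (simp add: M.normal_inv_iff)
  show "\<lbrakk>x \<in> I; y \<in> I\<rbrakk> \<Longrightarrow> x \<oplus> y \<in> I"
    using subgroup.m_closed [OF s(1)] by simp
  show "x \<in> I \<Longrightarrow> \<ominus> x \<in> I"
    using subgroup.m_inv_closed [OF s(1)] by (simp add: a_inv_def)
qed

section \<open>Stability of the span under endomorphisms of the additive group\<close>

lemma derived_gens_subset: "I \<subseteq> carrier B \<Longrightarrow> derived_gens B I \<subseteq> carrier B"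
  by (auto simp: derived_gens_def subset_iff)

lemma subgroup_derived_span:
  "I \<subseteq> carrier B \<Longrightarrow> subgroup (derived_span B I) (add_monoid B)"
  unfolding derived_span_def
  using A.generate_is_subgroup derived_gens_subset by simp

lemma derived_span_closed:
  assumes "I \<subseteq> carrier B"
  shows "\<lbrakk>x \<in> derived_span B I; y \<in> derived_span B I\<rbrakk> \<Longrightarrow> x \<oplus> y \<in> derived_span B I"
    and "x \<in> derived_span B I \<Longrightarrow> \<ominus> x \<in> derived_span B I"
    and "x \<in> derived_span B I \<Longrightarrow> x \<in> carrier B"
  using subgroup.m_closed [OF subgroup_derived_span [OF assms]]
    subgroup.m_inv_closed [OF subgroup_derived_span [OF assms]]
    subgroup.mem_carrier [OF subgroup_derived_span [OF assms]]
  by (simp_all add: a_inv_def)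

lemma add_commutator_in_span:
  "\<lbrakk>h \<in> I; k \<in> I\<rbrakk> \<Longrightarrow> h \<oplus> k \<oplus> \<ominus> h \<oplus> \<ominus> k \<in> derived_span B I"
  unfolding derived_span_def derived_gens_def by (rule generate.incl) blast

lemma lam_minus_in_span:
  "\<lbrakk>i \<in> I; j \<in> I\<rbrakk> \<Longrightarrow> lam i j \<oplus> \<ominus> j \<in> derived_span B I"
  unfolding derived_span_def derived_gens_def by (rule generate.incl) blast

text \<open>An additive endomorphism that preserves \<open>I\<close> sends additive commutators of
  \<open>I\<close> to such commutators, so only the generators \<open>i * j\<close> need checking.
  It serves for \<open>lam b\<close> and for both kinds of conjugation by \<open>b\<close>.\<close>

lemma derived_span_invariant:
  assumes f: "f \<in> hom (add_monoid B) (add_monoid B)"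
    and I: "I \<subseteq> carrier B" and fI: "\<And>x. x \<in> I \<Longrightarrow> f x \<in> I"
    and gen: "\<And>i j. \<lbrakk>i \<in> I; j \<in> I\<rbrakk> \<Longrightarrow> f (lam i j \<oplus> \<ominus> j) \<in> derived_span B I"
    and x: "x \<in> derived_span B I"
  shows "f x \<in> derived_span B I"
proof -
  interpret f: group_hom "add_monoid B" "add_monoid B" f
    by (simp add: group_hom_def group_hom_axioms_def add_group f)
  have "f (h \<oplus> k \<oplus> \<ominus> h \<oplus> \<ominus> k) = f h \<oplus> f k \<oplus> \<ominus> f h \<oplus> \<ominus> f k" if "h \<in> I" "k \<in> I" for h k
    using that I f.hom_mult add_end_minus [OF f] by (simp add: subset_iff)
  then have "f ` derived_gens B I \<subseteq> derived_span B I"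
    using gen fI add_commutator_in_span by (auto simp: derived_gens_def)
  then have "generate (add_monoid B) (f ` derived_gens B I) \<subseteq> derived_span B I"
    using A.generate_subgroup_incl subgroup_derived_span [OF I] by blast
  moreover have "f x \<in> generate (add_monoid B) (f ` derived_gens B I)"
    using x f.generate_img [of "derived_gens B I"] derived_gens_subset [OF I]
    by (auto simp: derived_span_def)
  ultimately show ?thesis by blast
qed

lemma derived_span_lam:
  assumes I: "brace_ideal B I" and b: "b \<in> carrier B" and x: "x \<in> derived_span B I"
  shows "lam b x \<in> derived_span B I"
proof (rule derived_span_invariant [OF lam_hom [OF b] _ _ _ x])
  note IB = subsetD [OF brace_idealD(3) [OF I]]
  fix i j assume i: "i \<in> I" and j: "j \<in> I"
  \<comment> \<open>Both sides equal \<open>lam (b \<otimes> i) j\<close>.\<close>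
  have "lam (b \<otimes> i \<otimes> inv b) (lam b j) = lam b (lam i j)"
    using b IB i j by (simp add: lam_lam [symmetric] M.m_assoc)
  then have "lam b (lam i j \<oplus> \<ominus> j) = lam (b \<otimes> i \<otimes> inv b) (lam b j) \<oplus> \<ominus> lam b j"
    using b IB i j by (simp add: lam_add lam_minus)
  then show "lam b (lam i j \<oplus> \<ominus> j) \<in> derived_span B I"
    using lam_minus_in_span brace_idealD(4,6) [OF I] b i j by simp
qed (use brace_idealD(3,4) [OF I] b in auto)

text \<open>Elements of \<open>I\<close> act trivially modulo \<open>I\<close> on all of
  \<open>B\<close>: multiplicative normality moves \<open>i\<close> past \<open>b\<close>, giving
  \<open>i \<otimes> b = b \<oplus> w\<close> with \<open>w\<close> in \<open>I\<close>, and
  additive normality absorbs the remaining conjugation of \<open>w\<close> by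
  \<open>b\<close>.\<close>

lemma lam_minus_in_ideal:
  assumes I: "brace_ideal B I" and i: "i \<in> I" and b: "b \<in> carrier B"
  shows "lam i b \<oplus> \<ominus> b \<in> I"
proof -
  have iB: "i \<in> carrier B" using brace_idealD(3) [OF I] i by blast
  define w where "w = lam b (inv b \<otimes> i \<otimes> b)"
  have w: "w \<in> I" "w \<in> carrier B"
    using brace_idealD(4) [OF I b] brace_idealD(6) [OF I, of "inv b" i] iB i b
    by (simp_all add: w_def)
  have "i \<otimes> b = b \<oplus> w"
    using b iB by (simp add: w_def M.m_assoc mult_eq_lam [symmetric])
  then have "lam i b \<oplus> \<ominus> b = \<ominus> i \<oplus> (b \<oplus> w \<oplus> \<ominus> b)"
    using b iB w by (simp add: brace_lambda_def A.m_assoc)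
  then show ?thesis using brace_idealD(5,7,8) [OF I] w b i by simp
qed

lemma derived_span_add_conj:
  assumes I: "brace_ideal B I" and b: "b \<in> carrier B" and x: "x \<in> derived_span B I"
  shows "b \<oplus> x \<oplus> \<ominus> b \<in> derived_span B I"
proof (rule derived_span_invariant [where f = "\<lambda>x. b \<oplus> x \<oplus> \<ominus> b", OF _ _ _ _ x])
  note IB = subsetD [OF brace_idealD(3) [OF I]]
  show "(\<lambda>x. b \<oplus> x \<oplus> \<ominus> b) \<in> hom (add_monoid B) (add_monoid B)"
    using b by (simp add: hom_def A.m_assoc)
  fix i j assume i: "i \<in> I" and j: "j \<in> I"
  define u where "u = lam i b \<oplus> \<ominus> b"
  define j' where "j' = b \<oplus> j \<oplus> \<ominus> b"
  have u: "\<ominus> u \<in> I" and j': "j' \<in> I"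
    using lam_minus_in_ideal [OF I i b] brace_idealD(5,8) [OF I] b j by (auto simp: u_def j'_def)
  have c: "i \<in> carrier B" "j \<in> carrier B" using i j IB by auto
  \<comment> \<open>In \<open>lam i j'\<close> the element \<open>lam i j\<close> is conjugated by
    \<open>lam i b\<close> instead of \<open>b\<close>. Conjugation by \<open>\<ominus> u\<close>
    corrects this, at the cost of an additive commutator of two elements of
    \<open>I\<close>.\<close>
  have "b \<oplus> (lam i j \<oplus> \<ominus> j) \<oplus> \<ominus> b =
      (\<ominus> u \<oplus> lam i j' \<oplus> \<ominus> (\<ominus> u) \<oplus> \<ominus> lam i j') \<oplus> (lam i j' \<oplus> \<ominus> j')"
    using b c by (simp add: u_def j'_def lam_add lam_minus add_word_simps)
  then show "b \<oplus> (lam i j \<oplus> \<ominus> j) \<oplus> \<ominus> b \<in> derived_span B I"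
    using add_commutator_in_span [OF u brace_idealD(4) [OF I c(1) j']]
      lam_minus_in_span [OF i j'] derived_span_closed(1) [OF brace_idealD(3) [OF I]] by simp
qed (use brace_idealD(3,5) [OF I] b in auto)

section \<open>The commutator of a skew brace with itself, and its restriction to an ideal\<close>

lemma brace_ideal_derived_span_carrier: "brace_ideal B (derived_span B (carrier B))"
proof (rule brace_idealI)
  let ?T = "derived_span B (carrier B)"
  note closed = derived_span_closed [OF order_refl]
  show "subgroup ?T (add_monoid B)" by (simp add: subgroup_derived_span)
  show l: "lam b x \<in> ?T" and "b \<oplus> x \<oplus> \<ominus> b \<in> ?T" if "b \<in> carrier B" "x \<in> ?T" for b x
    using derived_span_lam derived_span_add_conj brace_ideal_carrier that by auto
  fix b x assume b: "b \<in> carrier B" and x: "x \<in> ?T"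
  let ?g = "b \<otimes> x \<otimes> inv b"
  note c = b closed(3) [OF x]
  \<comment> \<open>From \<open>b \<otimes> x = ?g \<otimes> b\<close>; the inner term
    \<open>lam b (inv b)\<close> is then \<open>\<ominus> b\<close>.\<close>
  have "lam (b \<otimes> x) (inv b) = lam ?g (lam b (inv b))"
    using c by (simp add: lam_lam [symmetric] M.m_assoc)
  then have "?g = b \<otimes> x \<oplus> lam ?g (\<ominus> b)"
    using c by (simp add: lam_inv mult_eq_lam [of "b \<otimes> x" "inv b"])
  \<comment> \<open>The inner summand after \<open>lam b x\<close> is the generator
    \<open>?g * (\<ominus> b)\<close>, available because \<open>\<ominus> b\<close> itself lies in
    the carrier.\<close>
  also have "\<dots> = b \<oplus> (lam b x \<oplus> (lam ?g (\<ominus> b) \<oplus> \<ominus> (\<ominus> b))) \<oplus> \<ominus> b"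
    using c by (simp add: mult_eq_lam [of b x] A.m_assoc)
  also have "\<dots> \<in> ?T"
    using c x
    by (intro derived_span_add_conj [OF brace_ideal_carrier] closed(1) l lam_minus_in_span) auto
  finally show "?g \<in> ?T" .
qed

text \<open>The element is the additive conjugate by \<open>i\<close> of the generator
  \<open>i * j\<close>.\<close>

lemma mult_diff_in_span:
  assumes "i \<in> carrier B" "j \<in> carrier B"
  shows "i \<otimes> j \<oplus> \<ominus> (i \<oplus> j) \<in> derived_span B (carrier B)"
proof -
  have "i \<otimes> j \<oplus> \<ominus> (i \<oplus> j) = i \<oplus> (lam i j \<oplus> \<ominus> j) \<oplus> \<ominus> i"
    using assms by (simp add: mult_eq_lam add_word_simps)
  then show ?thesis
    using assms derived_span_add_conj [OF brace_ideal_carrier] lam_minus_in_span by simp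
qed

text \<open>Comparing \<open>i \<otimes> j\<close> and \<open>j \<otimes> i\<close> with the
  corresponding sums reduces the multiplicative commutator to the additive one, up to elements of
  the span.\<close>

lemma mult_commutator_in_span:
  assumes i: "i \<in> carrier B" and j: "j \<in> carrier B"
  shows "i \<otimes> j \<otimes> inv i \<otimes> inv j \<in> derived_span B (carrier B)"
proof -
  let ?T = "derived_span B (carrier B)"
  note closed = derived_span_closed [OF order_refl]
  let ?p = "i \<otimes> j" and ?q = "j \<otimes> i"
  \<comment> \<open>This is the multiplicative commutator itself, written so that
    \<open>?p = c \<otimes> ?q\<close>.\<close>
  define c where "c = ?p \<otimes> inv ?q"
  have cB: "c \<in> carrier B" using i j by (simp add: c_def)
  have "lam ?p (inv ?q) = lam c (lam ?q (inv ?q))"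
    using i j by (simp add: c_def lam_lam [symmetric] M.m_assoc M.inv_mult_group)
  then have "c = ?p \<oplus> lam c (\<ominus> ?q)"
    using i j by (simp add: lam_inv c_def mult_eq_lam [of ?p])
  \<comment> \<open>A telescoping sum through \<open>i \<oplus> j\<close>,
    \<open>j \<oplus> i\<close> and \<open>?q\<close>; the last bracket is the additive conjugate by
    \<open>?q\<close> of the generator \<open>c * (\<ominus> ?q)\<close>.\<close>
  also have "\<dots> = (?p \<oplus> \<ominus> (i \<oplus> j)) \<oplus> (i \<oplus> j \<oplus> \<ominus> i \<oplus> \<ominus> j) \<oplus> \<ominus> (?q \<oplus> \<ominus> (j \<oplus> i))
      \<oplus> (?q \<oplus> (lam c (\<ominus> ?q) \<oplus> \<ominus> (\<ominus> ?q)) \<oplus> \<ominus> ?q)"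
    using i j cB by (simp add: add_word_simps)
  also have "\<dots> \<in> ?T"
    using i j cB
    by (intro closed(1,2) mult_diff_in_span add_commutator_in_span
        derived_span_add_conj [OF brace_ideal_carrier] lam_minus_in_span) auto
  finally show ?thesis using i j by (simp add: c_def M.inv_mult_group M.m_assoc)
qed

lemma brace_commutator_carrier:
  "brace_commutator B (carrier B) (carrier B) = derived_span B (carrier B)"
proof -
  let ?T = "derived_span B (carrier B)" and ?C = "carrier B"
  define S where "S = commutator_subgroup (add_monoid B) ?C ?C \<union> commutator_subgroup B ?C ?C \<union>
       {i \<otimes> j \<ominus> (i \<oplus> j) | i j. i \<in> ?C \<and> j \<in> ?C}"
  note T = brace_ideal_derived_span_carrier
  have inv_add: "inv\<^bsub>add_monoid B\<^esub> x = \<ominus> x" for x by (simp add: a_inv_def)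
  have "commutator_subgroup (add_monoid B) ?C ?C \<subseteq> ?T"
    unfolding commutator_subgroup_def derived_span_def derived_gens_def
    by (rule A.mono_generate) (auto simp: inv_add)
  moreover have "commutator_subgroup B ?C ?C \<subseteq> ?T"
    unfolding commutator_subgroup_def
    by (rule M.generate_subgroup_incl [OF _ brace_idealD(2) [OF T]])
      (use mult_commutator_in_span in auto)
  ultimately have ST: "S \<subseteq> ?T"
    using mult_diff_in_span by (auto simp: S_def a_minus_def)
  have "?T \<subseteq> K" if K: "brace_ideal B K" and SK: "S \<subseteq> K" for K
  proof -
    have "h \<oplus> k \<oplus> \<ominus> h \<oplus> \<ominus> k \<in> K" if "h \<in> ?C" "k \<in> ?C" for h k
    proof -
      have "h \<oplus> k \<oplus> \<ominus> h \<oplus> \<ominus> k \<in> commutator_subgroup (add_monoid B) ?C ?C"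
        unfolding commutator_subgroup_def
        by (rule generate.incl) (use that in \<open>auto simp: inv_add\<close>)
      then show ?thesis using SK by (auto simp: S_def)
    qed
    moreover have "lam i j \<oplus> \<ominus> j \<in> K" if ij: "i \<in> ?C" "j \<in> ?C" for i j
    proof -
      have "i \<otimes> j \<oplus> \<ominus> (i \<oplus> j) \<in> K" using SK ij unfolding S_def a_minus_def by blast
      \<comment> \<open>Conjugation by \<open>\<ominus> i\<close> reverses the relation of
        \<open>mult_diff_in_span\<close> and recovers \<open>i * j\<close>.\<close>
      then have "\<ominus> i \<oplus> (i \<otimes> j \<oplus> \<ominus> (i \<oplus> j)) \<oplus> \<ominus> (\<ominus> i) \<in> K"
        by (rule brace_idealD(5) [OF K, rotated]) (simp add: ij)
      then show ?thesis using ij by (simp add: mult_eq_lam add_word_simps)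
    qed
    ultimately have "derived_gens B ?C \<subseteq> K" by (auto simp: derived_gens_def)
    then show ?thesis
      unfolding derived_span_def
      using A.generate_subgroup_incl brace_idealD(1) [OF K] by blast
  qed
  then show ?thesis
    unfolding brace_commutator_def brace_ideal_generated_def S_def [symmetric]
    using ST T by (intro equalityI) blast+
qed

text \<open>Negatives in \<open>I\<close> and in \<open>B\<close> agree and all generators lie in
  \<open>I\<close>, so generating in either additive group gives the same subgroup. This carries the
  computation made inside \<open>I\<close> over to \<open>B\<close>.\<close>

lemma derived_span_restrict:
  assumes I: "brace_ideal B I"
  shows "derived_span (B\<lparr>carrier := I\<rparr>) I = derived_span B I"
proof -
  let ?R = "B\<lparr>carrier := I\<rparr>"
  have s: "subgroup I (add_monoid B)" using brace_idealD(1) [OF I] .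
  have R: "add_monoid ?R = (add_monoid B)\<lparr>carrier := I\<rparr>" by simp
  have inv: "\<ominus>\<^bsub>?R\<^esub> x = \<ominus> x" if "x \<in> I" for x
    using group.m_inv_consistent [OF add_group s that] by (simp add: a_inv_def)
  then have g: "derived_gens ?R I = derived_gens B I"
    unfolding derived_gens_def brace_lambda_def
    by (intro arg_cong2 [where f = "(\<union>)"] Collect_cong) (simp_all, (metis inv)+)
  have "derived_gens B I \<subseteq> I"
    using brace_idealD(4,7,8) [OF I] brace_idealD(3) [OF I] by (auto simp: derived_gens_def)
  then have "generate (add_monoid ?R) (derived_gens B I) = generate (add_monoid B) (derived_gens B I)"
    unfolding R using group.generate_consistent [OF add_group _ s] by metis
  then show ?thesis unfolding derived_span_def g .
qed

text \<open>The ideal is a skew brace with carrier \<open>I\<close>, so the case of a whole skew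
  brace applies to it.\<close>

lemma brace_derived_series_one_eq_span:
  assumes "brace_ideal B I"
  shows "brace_derived_series (B\<lparr>carrier := I\<rparr>) I 1 = derived_span B I"
  using skew_brace.brace_commutator_carrier [OF skew_brace_restrict [OF assms]]
  by (simp add: derived_span_restrict [OF assms])

end

section \<open>Two-sided skew braces: multiplicative conjugation\<close>

context two_sided_skew_brace
begin

text \<open>The two distributive laws leave a term \<open>\<ominus> b \<otimes> inv b\<close>
  between copies of \<open>\<ominus> inv b\<close>; everything extra cancels because that term
  equals \<open>inv b \<oplus> inv b\<close>.\<close>

lemma mult_conj_add:
  assumes b: "b \<in> carrier B" and x: "x \<in> carrier B" and y: "y \<in> carrier B"
  shows "b \<otimes> (x \<oplus> y) \<otimes> inv b = b \<otimes> x \<otimes> inv b \<oplus> b \<otimes> y \<otimes> inv b"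
proof -
  let ?c = "inv b"
  have c: "?c \<in> carrier B" using b by simp
  \<comment> \<open>The left side is \<open>?c\<close>, as zero is also the multiplicative identity;
    expanding the right side then determines \<open>\<ominus> b \<otimes> ?c\<close>.\<close>
  have "\<zero> \<otimes> ?c = (\<ominus> b \<oplus> b) \<otimes> ?c" using b by simp
  also have "\<dots> = \<ominus> b \<otimes> ?c \<oplus> \<ominus> ?c"
    using b skew_distrib_right [of "\<ominus> b" b ?c] by (simp add: a_minus_def zero_eq_one [symmetric])
  finally have "\<ominus> b \<otimes> ?c \<oplus> \<ominus> ?c = ?c" using b by (simp add: zero_eq_one)
  then have *: "\<ominus> b \<otimes> ?c = ?c \<oplus> ?c"
    using b by (metis A.inv_closed A.inv_solve_right M.inv_closed M.m_closed)
  have "b \<otimes> (x \<oplus> y) \<otimes> ?c = (b \<otimes> x \<oplus> (\<ominus> b \<oplus> b \<otimes> y)) \<otimes> ?c"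
    using b x y by (simp add: skew_distrib a_minus_def A.m_assoc)
  also have "\<dots> = b \<otimes> x \<otimes> ?c \<oplus> \<ominus> ?c \<oplus> (\<ominus> b \<otimes> ?c \<oplus> \<ominus> ?c \<oplus> b \<otimes> y \<otimes> ?c)"
    using b x y by (simp add: skew_distrib_right a_minus_def)
  also have "\<dots> = b \<otimes> x \<otimes> ?c \<oplus> b \<otimes> y \<otimes> ?c"
    using b x y by (simp add: * A.m_assoc)
  finally show ?thesis .
qed

lemma mult_conj_hom:
  "b \<in> carrier B \<Longrightarrow> (\<lambda>x. b \<otimes> x \<otimes> inv b) \<in> hom (add_monoid B) (add_monoid B)"
  by (simp add: hom_def mult_conj_add)

lemma derived_span_mult_conj:
  assumes I: "brace_ideal B I" and b: "b \<in> carrier B" and x: "x \<in> derived_span B I"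
  shows "b \<otimes> x \<otimes> inv b \<in> derived_span B I"
proof (rule derived_span_invariant [OF mult_conj_hom [OF b] _ _ _ x])
  fix i j assume i: "i \<in> I" and j: "j \<in> I"
  let ?f = "\<lambda>x. b \<otimes> x \<otimes> inv b"
  have c: "i \<in> carrier B" "j \<in> carrier B" using i j brace_idealD(3) [OF I] by auto
  \<comment> \<open>Respecting both operations, conjugation sends \<open>i * j\<close> to
    \<open>?f i * ?f j\<close>, again a generator.\<close>
  have "?f (i \<otimes> j) = ?f i \<otimes> ?f j" using b c by (simp add: M.m_assoc)
  then have "?f (lam i j) = lam (?f i) (?f j)"
    using b c by (simp add: brace_lambda_def mult_conj_add add_end_minus [OF mult_conj_hom [OF b]])
  then have "?f (lam i j \<oplus> \<ominus> j) = lam (?f i) (?f j) \<oplus> \<ominus> ?f j"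
    using b c by (simp add: mult_conj_add add_end_minus [OF mult_conj_hom [OF b]])
  then show "?f (lam i j \<oplus> \<ominus> j) \<in> derived_span B I"
    using lam_minus_in_span brace_idealD(6) [OF I] b i j by simp
qed (use brace_idealD(3,6) [OF I] b in auto)

lemma brace_ideal_derived_span:
  assumes "brace_ideal B I"
  shows "brace_ideal B (derived_span B I)"
  by (rule brace_idealI)
    (use assms brace_idealD(3) subgroup_derived_span
      derived_span_lam derived_span_add_conj derived_span_mult_conj in auto)

end

theorem theorem2:
  fixes B :: "('a, 'm) ring_scheme"
    and I :: "'a set"
  assumes "two_sided_skew_brace B"
    and "brace_ideal B I"
  shows "brace_ideal B (brace_derived_series (B\<lparr>carrier := I\<rparr>) I 1)"
proof -
  interpret two_sided_skew_brace B by (rule assms(1))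
  show ?thesis
    using brace_ideal_derived_span [OF assms(2)] brace_derived_series_one_eq_span [OF assms(2)]
    by simp
qed

end
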